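(* Let $\alpha>0$, $\nu\in\mathcal{P}_+$, let $\{N(t):t\ge0\}$ be the renewal process for the Kendall convolution $\vartriangle_\alpha$ with unit step distribution $\nu$, and let $F_n$ be the cumulative distribution function of $\nu^{\vartriangle_\alpha n}$. Then for all $n\ge1$ and $t>0$ $$F_n(t)=G(t)^{n-1}\bigl[n(F(t)-G(t))+G(t)\bigr]=G(t)^{n-1}\bigl[n\,t^{-\alpha}H(t)+G(t)\bigr].$$ Consequently, $\mathbf{P}\{N(t)=0\}=\overline{F}(t)$ and, for all $n\ge1$, $$\mathbf{P}\{N(t)=n\}=G(t)^{n-1}\bigl[n\,(F(t)-G(t))\,\overline{G}(t)+G(t)\,\overline{F}(t)\bigr].$$
   Context: $\mathcal{P}_+$ is the set of Borel probability measures on $[0,\infty)$. For $\alpha>0$ the Kendall convolution $\vartriangle_\alpha$ is the commutative, associative operation on $\mathcal{P}_+$ given by $\delta_x\vartriangle_\alpha\delta_1=(1-x^\alpha)\delta_1+x^\alpha\pi_{2\alpha}$ for $x\in[0,1]$, where $\pi_{2\alpha}(dy)=2\alpha y^{-2\alpha-1}\mathbf{1}_{[1,\infty)}(y)\,dy$; by scaling, for $0\le x\le y$, $y>0$, $\delta_x\vartriangle_\alpha\delta_y$ is the law of $yX$ where $X$ has law $\delta_{x/y}\vartriangle_\alpha\delta_1$; $\delta_0\vartriangle_\alpha\delta_0=\delta_0$; and $(\lambda_1\vartriangle_\alpha\lambda_2)(A)=\int\int(\delta_x\vartriangle_\alpha\delta_y)(A)\,\lambda_1(dx)\lambda_2(dy)$.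 $\nu^{\vartriangle_\alpha n}$ is the $n$-fold convolution power. The Kendall random walk with step distribution $\nu$ is the Markov process $(S_n)_{n\ge1}$ with $\mathcal{L}(S_1)=\nu$ and $P(S_n\in\cdot\mid S_k=x)=\delta_x\vartriangle_\alpha\nu^{\vartriangle_\alpha(n-k)}$ for $k<n$. The renewal process is $N(t)=\inf\{n\ge0:S_{n+1}>t\}$ ($=\infty$ if no such $n$ exists). Cumulative distribution functions are right-continuous; $F(t)=\nu([0,t])$, $\overline F=1-F$. For $t>0$: $G(t)=\int_{[0,\infty)}(1-x^\alpha/t^\alpha)_+\,\nu(dx)$, $\overline{G}=1-G$, $H(t)=\int_{[0,t]}x^\alpha\,\nu(dx)$, where $a_+=\max\{a,0\}$. Convention: $0^0=1$. *)

theory Defs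
  imports "HOL-Probability.Probability" "HOL-Real_Asymp.Real_Asymp"
begin

text \<open>
  Laws on the half-line are measures whose underlying space is \<open>{0..}\<close>. Hence Markov kernels
  such as the Kendall convolution of two point masses need to make sense for nonnegative
  arguments only. On the other hand the library's \<open>cdf\<close>, which measures \<open>{..t}\<close>, is of no use
  for such measures, because \<open>{..t}\<close> is not one of their measurable sets.
\<close>

definition half_line :: "real measure" where
  "half_line = restrict_space borel {0..}"

definition P_plus :: "real measure set" where
  "P_plus = {\<nu>. prob_space \<nu> \<and> sets \<nu> = sets half_line}"

definition cdf_plus :: "real measure \<Rightarrow> real \<Rightarrow> real" where
  "cdf_plus \<nu> t = measure \<nu> {0..t}"

definition pareto :: "real \<Rightarrow> real measure" where
  "pareto \<beta> = density (restrict_space lborel {0..})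
     (\<lambda>y. ennreal (\<beta> * y powr (- \<beta> - 1)) * indicator {1..} y)"

definition kendall_unit :: "real \<Rightarrow> real \<Rightarrow> real measure" where
  "kendall_unit \<alpha> x = measure_of {0..} (sets half_line)
     (\<lambda>A. ennreal (1 - x powr \<alpha>) * emeasure (return half_line 1) A
        + ennreal (x powr \<alpha>) * emeasure (pareto (2 * \<alpha>)) A)"

text \<open>Intended for \<open>x, y \<ge> 0\<close>; by commutativity the smaller point is rescaled by the larger.\<close>

definition kendall_dirac :: "real \<Rightarrow> real \<Rightarrow> real \<Rightarrow> real measure" where
  "kendall_dirac \<alpha> x y =
     (if max x y = 0 then return half_line 0
      else distr (kendall_unit \<alpha> (min x y / max x y)) half_line (\<lambda>z. max x y * z))"

definition kendall_conv :: "real \<Rightarrow> real measure \<Rightarrow> real measure \<Rightarrow> real measure" where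
  "kendall_conv \<alpha> \<mu> \<nu> = \<mu> \<bind> (\<lambda>x. \<nu> \<bind> (\<lambda>y. kendall_dirac \<alpha> x y))"

text \<open>The point mass at 0 is the neutral element, so the first power is \<open>\<nu>\<close> itself
  (\<open>kendall_power_1\<close> below).\<close>

primrec kendall_power :: "real \<Rightarrow> real measure \<Rightarrow> nat \<Rightarrow> real measure" where
  "kendall_power \<alpha> \<nu> 0 = return half_line 0"
| "kendall_power \<alpha> \<nu> (Suc n) = kendall_conv \<alpha> (kendall_power \<alpha> \<nu> n) \<nu>"

definition kendall_G :: "real \<Rightarrow> real measure \<Rightarrow> real \<Rightarrow> real" where
  "kendall_G \<alpha> \<nu> t = (\<integral>x. max (1 - x powr \<alpha> / t powr \<alpha>) 0 \<partial>\<nu>)"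

definition kendall_H :: "real \<Rightarrow> real measure \<Rightarrow> real \<Rightarrow> real" where
  "kendall_H \<alpha> \<nu> t = (\<integral>x\<in>{0..t}. x powr \<alpha> \<partial>\<nu>)"

definition past :: "'a measure \<Rightarrow> (nat \<Rightarrow> 'a \<Rightarrow> real) \<Rightarrow> nat \<Rightarrow> 'a measure" where
  "past M S k = sigma (space M)
     {S i -` A \<inter> space M | i A. 1 \<le> i \<and> i \<le> k \<and> A \<in> sets half_line}"

definition present :: "'a measure \<Rightarrow> (nat \<Rightarrow> 'a \<Rightarrow> real) \<Rightarrow> nat \<Rightarrow> 'a measure" where
  "present M S k = vimage_algebra (space M) (S k) half_line"

text \<open>The process is indexed by \<open>n \<ge> 1\<close>; the value \<open>S 0\<close> is unconstrained and never used.
  Conditional probabilities are conditional expectations of indicators, so that the assumption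
  \<open>transition\<close> says that the displayed kernel is a version of the conditional law of \<open>S n\<close>
  given \<open>S k\<close>.\<close>

locale kendall_random_walk = prob_space M
  for M :: "'a measure" and \<alpha> :: real and \<nu> :: "real measure" and S :: "nat \<Rightarrow> 'a \<Rightarrow> real" +
  assumes random_variable: "1 \<le> n \<Longrightarrow> S n \<in> measurable M half_line"
    and initial: "distr M half_line (S 1) = \<nu>"
    and markov: "\<lbrakk>1 \<le> k; k < n; A \<in> sets half_line\<rbrakk> \<Longrightarrow>
      AE \<omega> in M. real_cond_exp M (past M S k) (indicator (S n -` A \<inter> space M)) \<omega> =
                 real_cond_exp M (present M S k) (indicator (S n -` A \<inter> space M)) \<omega>"
    and transition: "\<lbrakk>1 \<le> k; k < n; A \<in> sets half_line\<rbrakk> \<Longrightarrow>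
      AE \<omega> in M. real_cond_exp M (present M S k) (indicator (S n -` A \<inter> space M)) \<omega> =
        measure (kendall_conv \<alpha> (return half_line (S k \<omega>)) (kendall_power \<alpha> \<nu> (n - k))) A"

definition renewal :: "(nat \<Rightarrow> 'a \<Rightarrow> real) \<Rightarrow> real \<Rightarrow> 'a \<Rightarrow> enat" where
  "renewal S t \<omega> = Inf (enat ` {n. S (Suc n) \<omega> > t})"

lemma space_half_line [simp]: "space half_line = {0..}"
  by (simp add: half_line_def space_restrict_space)

lemma sets_half_line: "A \<in> sets half_line \<longleftrightarrow> A \<in> sets borel \<and> A \<subseteq> {0..}"
  by (auto simp: half_line_def sets_restrict_space_iff)

lemma sets_pareto [simp, measurable_cong]: "sets (pareto \<beta>) = sets half_line"
  by (simp add: pareto_def half_line_def sets_restrict_space)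

lemma space_pareto [simp]: "space (pareto \<beta>) = {0..}"
  by (simp add: pareto_def space_restrict_space)

lemma borel_measurable_half_line: "f \<in> borel_measurable borel \<Longrightarrow> f \<in> borel_measurable half_line"
  by (simp add: half_line_def measurable_restrict_space1)

lemma prob_space_pareto:
  assumes "\<beta> > 0"
  shows "prob_space (pareto \<beta>)"
proof
  have "emeasure (pareto \<beta>) (space (pareto \<beta>)) =
      (\<integral>\<^sup>+y. ennreal (\<beta> * y powr (- \<beta> - 1)) * indicator {1..} y \<partial>restrict_space lborel {0..})"
    unfolding space_pareto unfolding pareto_def
    by (subst emeasure_density)
       (auto simp: sets_restrict_space_iff indicator_def intro!: nn_integral_cong measurable_restrict_space1)
  also have "\<dots> = (\<integral>\<^sup>+y. ennreal (\<beta> * y powr (- \<beta> - 1)) * indicator {1..} y \<partial>lborel)"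
    by (subst nn_integral_restrict_space) (auto simp: indicator_def intro!: nn_integral_cong)
  also have "\<dots> = ennreal (0 - (- (1 powr (- \<beta>))))"
  proof (rule nn_integral_FTC_atLeast)
    show "DERIV (\<lambda>y. - (y powr (- \<beta>))) x :> \<beta> * x powr (- \<beta> - 1)" if "1 \<le> x" for x
      using that by (auto intro!: derivative_eq_intros simp: powr_diff)
    show "((\<lambda>y. - (y powr (- \<beta>))) \<longlongrightarrow> 0) at_top"
      using assms by real_asymp
  qed (use assms in auto)
  finally show "emeasure (pareto \<beta>) (space (pareto \<beta>)) = 1" by simp
qed

lemma sets_kendall_unit [simp, measurable_cong]: "sets (kendall_unit \<alpha> x) = sets half_line"
  unfolding kendall_unit_def
  by (metis sets.sets_measure_of_eq space_half_line)

lemma space_kendall_unit [simp]: "space (kendall_unit \<alpha> x) = {0..}"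
  using sets_eq_imp_space_eq[OF sets_kendall_unit] by simp

lemma emeasure_kendall_unit:
  assumes "A \<in> sets half_line"
  shows "emeasure (kendall_unit \<alpha> x) A =
    ennreal (1 - x powr \<alpha>) * emeasure (return half_line 1) A
      + ennreal (x powr \<alpha>) * emeasure (pareto (2 * \<alpha>)) A"
proof (rule emeasure_measure_of[OF kendall_unit_def])
  show "sets half_line \<subseteq> Pow {0..}"
    using sets.space_closed[of half_line] by simp
  show "countably_additive (sets (kendall_unit \<alpha> x))
     (\<lambda>A. ennreal (1 - x powr \<alpha>) * emeasure (return half_line 1) A
        + ennreal (x powr \<alpha>) * emeasure (pareto (2 * \<alpha>)) A)"
  proof (rule countably_additiveI)
    fix A :: "nat \<Rightarrow> real set"
    assume "range A \<subseteq> sets (kendall_unit \<alpha> x)" "disjoint_family A"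
    then have "(\<Sum>i. emeasure (return half_line 1) (A i)) = emeasure (return half_line 1) (\<Union>(range A))"
      and "(\<Sum>i. emeasure (pareto (2 * \<alpha>)) (A i)) = emeasure (pareto (2 * \<alpha>)) (\<Union>(range A))"
      by (intro suminf_emeasure; simp)+
    then show "(\<Sum>i. ennreal (1 - x powr \<alpha>) * emeasure (return half_line 1) (A i)
          + ennreal (x powr \<alpha>) * emeasure (pareto (2 * \<alpha>)) (A i)) =
        ennreal (1 - x powr \<alpha>) * emeasure (return half_line 1) (\<Union>(range A))
          + ennreal (x powr \<alpha>) * emeasure (pareto (2 * \<alpha>)) (\<Union>(range A))"
      by (simp add: suminf_add[symmetric] del: emeasure_return)
  qed
qed (use assms in \<open>auto simp: positive_def\<close>)

lemma prob_space_kendall_unit: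
  assumes "\<alpha> > 0" "0 \<le> x" "x \<le> 1"
  shows "prob_space (kendall_unit \<alpha> x)"
proof
  interpret P: prob_space "pareto (2 * \<alpha>)"
    using assms by (intro prob_space_pareto) simp
  have "x powr \<alpha> \<le> 1" using assms by (simp add: powr_le1)
  moreover have "{0..} \<in> sets half_line" by (simp add: sets_half_line)
  ultimately show "emeasure (kendall_unit \<alpha> x) (space (kendall_unit \<alpha> x)) = 1"
    using P.emeasure_space_1
    by (simp add: emeasure_kendall_unit ennreal_plus[symmetric] del: ennreal_plus)
qed

lemma measurable_scale_half_line:
  "0 \<le> m \<Longrightarrow> (\<lambda>z. m * z) \<in> measurable half_line half_line"
  unfolding half_line_def by (intro measurable_restrict_space3) auto

lemma sets_kendall_dirac [simp, measurable_cong]: "sets (kendall_dirac \<alpha> x y) = sets half_line"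
  by (simp add: kendall_dirac_def)

lemma emeasure_kendall_dirac:
  assumes "0 \<le> x" "0 \<le> y" "max x y > 0" "A \<in> sets half_line"
  shows "emeasure (kendall_dirac \<alpha> x y) A =
    ennreal (1 - (min x y / max x y) powr \<alpha>) * indicator A (max x y)
    + ennreal ((min x y / max x y) powr \<alpha>)
        * (\<integral>\<^sup>+z. indicator A (max x y * z) \<partial>pareto (2 * \<alpha>))"
proof -
  let ?m = "max x y"
  have m: "0 \<le> ?m" using assms by simp
  have meas: "(\<lambda>z. ?m * z) \<in> measurable half_line half_line"
    by (rule measurable_scale_half_line[OF m])
  have B: "(\<lambda>z. ?m * z) -` A \<inter> {0..} \<in> sets half_line"
    using measurable_sets[OF meas assms(4)] by simp
  have "emeasure (pareto (2 * \<alpha>)) ((\<lambda>z. ?m * z) -` A \<inter> {0..}) =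
      (\<integral>\<^sup>+z. indicator ((\<lambda>z. ?m * z) -` A \<inter> {0..}) z \<partial>pareto (2 * \<alpha>))"
    using B by (subst nn_integral_indicator) auto
  also have "\<dots> = (\<integral>\<^sup>+z. indicator A (?m * z) \<partial>pareto (2 * \<alpha>))"
    by (intro nn_integral_cong) (auto simp: indicator_def)
  finally have p: "emeasure (pareto (2 * \<alpha>)) ((\<lambda>z. ?m * z) -` A \<inter> {0..}) =
      (\<integral>\<^sup>+z. indicator A (?m * z) \<partial>pareto (2 * \<alpha>))" .
  have "emeasure (kendall_dirac \<alpha> x y) A =
      emeasure (kendall_unit \<alpha> (min x y / ?m)) ((\<lambda>z. ?m * z) -` A \<inter> {0..})"
    using assms meas unfolding kendall_dirac_def
    by (simp add: emeasure_distr measurable_cong_sets[OF sets_kendall_unit refl])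
  also have "\<dots> = ennreal (1 - (min x y / ?m) powr \<alpha>) * indicator A ?m
      + ennreal ((min x y / ?m) powr \<alpha>) * (\<integral>\<^sup>+z. indicator A (?m * z) \<partial>pareto (2 * \<alpha>))"
    unfolding emeasure_kendall_unit[OF B] p using B by (simp add: indicator_def)
  finally show ?thesis .
qed

lemma prob_space_kendall_dirac:
  assumes "\<alpha> > 0" "0 \<le> x" "0 \<le> y"
  shows "prob_space (kendall_dirac \<alpha> x y)"
proof (cases "max x y = 0")
  case True
  then show ?thesis by (simp add: kendall_dirac_def prob_space_return)
next
  case False
  interpret prob_space "kendall_unit \<alpha> (min x y / max x y)"
    using assms False by (intro prob_space_kendall_unit) (auto simp: divide_simps max_def)
  have "(\<lambda>z. max x y * z) \<in> measurable (kendall_unit \<alpha> (min x y / max x y)) half_line"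
    using assms measurable_scale_half_line[of "max x y"]
    by (simp add: measurable_cong_sets[OF sets_kendall_unit refl])
  from prob_space_distr[OF this] show ?thesis
    using False unfolding kendall_dirac_def by simp
qed

lemma measurable_kendall_dirac:
  assumes "\<alpha> > 0"
  shows "(\<lambda>(x, y). kendall_dirac \<alpha> x y) \<in> measurable (half_line \<Otimes>\<^sub>M half_line) (prob_algebra half_line)"
proof -
  interpret P: prob_space "pareto (2 * \<alpha>)"
    using assms by (intro prob_space_pareto) simp
  have i: "(\<lambda>x. x) \<in> borel_measurable half_line"
    by (rule borel_measurable_half_line) simp
  have [measurable]: "fst \<in> borel_measurable (half_line \<Otimes>\<^sub>M half_line)"
      "snd \<in> borel_measurable (half_line \<Otimes>\<^sub>M half_line)"
    by (rule measurable_compose[OF measurable_fst i] measurable_compose[OF measurable_snd i])+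
  have "(\<lambda>p. kendall_dirac \<alpha> (fst p) (snd p)) \<in> measurable (half_line \<Otimes>\<^sub>M half_line) (subprob_algebra half_line)"
  proof (rule measurable_subprob_algebra)
    fix p assume "p \<in> space (half_line \<Otimes>\<^sub>M half_line)"
    then show "subprob_space (kendall_dirac \<alpha> (fst p) (snd p))"
      using assms by (auto simp: space_pair_measure intro!: prob_space_imp_subprob_space prob_space_kendall_dirac)
  next
    fix A assume A: "A \<in> sets half_line"
    then have [measurable]: "A \<in> sets borel" by (simp add: sets_half_line)
    have [measurable]: "(\<lambda>z. z) \<in> borel_measurable (pareto (2 * \<alpha>))"
      by (simp add: measurable_cong_sets[OF sets_pareto refl] borel_measurable_half_line)
    let ?f = "\<lambda>p::real \<times> real. if max (fst p) (snd p) = 0 then indicator A 0 else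
        ennreal (1 - (min (fst p) (snd p) / max (fst p) (snd p)) powr \<alpha>) * indicator A (max (fst p) (snd p))
        + ennreal ((min (fst p) (snd p) / max (fst p) (snd p)) powr \<alpha>)
            * (\<integral>\<^sup>+z. indicator A (max (fst p) (snd p) * z) \<partial>pareto (2 * \<alpha>))"
    have "?f \<in> borel_measurable (half_line \<Otimes>\<^sub>M half_line)"
      by measurable
    moreover have "emeasure (kendall_dirac \<alpha> (fst p) (snd p)) A = ?f p"
      if "p \<in> space (half_line \<Otimes>\<^sub>M half_line)" for p
    proof (cases "max (fst p) (snd p) = 0")
      case True
      then show ?thesis using A by (simp add: kendall_dirac_def)
    next
      case False
      with that have "0 \<le> fst p" "0 \<le> snd p" "max (fst p) (snd p) > 0"
        by (auto simp: space_pair_measure)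
      with False A show ?thesis by (simp add: emeasure_kendall_dirac)
    qed
    ultimately show "(\<lambda>p. emeasure (kendall_dirac \<alpha> (fst p) (snd p)) A)
        \<in> borel_measurable (half_line \<Otimes>\<^sub>M half_line)"
      by (subst measurable_cong[where g = ?f]) auto
  qed simp
  then show ?thesis
    using assms unfolding prob_algebra_def case_prod_beta
    by (intro measurable_restrict_space2) (auto simp: space_pair_measure intro!: prob_space_kendall_dirac)
qed

lemma P_plus_eq: "P_plus = space (prob_algebra half_line)"
  by (auto simp: P_plus_def space_prob_algebra)

lemma measurable_kendall_dirac_section:
  assumes "\<alpha> > 0" "\<nu> \<in> P_plus"
  shows "(\<lambda>x. \<nu> \<bind> (\<lambda>y. kendall_dirac \<alpha> x y)) \<in> measurable half_line (prob_algebra half_line)"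
  using assms measurable_kendall_dirac
  by (intro measurable_bind_prob_space2[where N = half_line] measurable_const) (auto simp: P_plus_eq)

lemma kendall_conv_P_plus:
  assumes "\<alpha> > 0" "\<mu> \<in> P_plus" "\<nu> \<in> P_plus"
  shows "kendall_conv \<alpha> \<mu> \<nu> \<in> P_plus"
  unfolding kendall_conv_def P_plus_eq space_prob_algebra mem_Collect_eq
proof
  note m = measurable_kendall_dirac_section[OF assms(1,3)]
  show "prob_space (\<mu> \<bind> (\<lambda>x. \<nu> \<bind> (\<lambda>y. kendall_dirac \<alpha> x y)))"
    using assms(2) m unfolding P_plus_eq by (rule prob_space_bind')
  show "sets (\<mu> \<bind> (\<lambda>x. \<nu> \<bind> (\<lambda>y. kendall_dirac \<alpha> x y))) = sets half_line"
    using assms(2) m unfolding P_plus_eq by (rule sets_bind')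
qed

lemma emeasure_kendall_conv:
  assumes "\<alpha> > 0" "\<mu> \<in> P_plus" "\<nu> \<in> P_plus" "A \<in> sets half_line"
  shows "emeasure (kendall_conv \<alpha> \<mu> \<nu>) A =
    (\<integral>\<^sup>+x. \<integral>\<^sup>+y. emeasure (kendall_dirac \<alpha> x y) A \<partial>\<nu> \<partial>\<mu>)"
proof -
  note m = measurable_kendall_dirac_section[OF assms(1,3)]
  have "emeasure (kendall_conv \<alpha> \<mu> \<nu>) A = (\<integral>\<^sup>+x. emeasure (\<nu> \<bind> (\<lambda>y. kendall_dirac \<alpha> x y)) A \<partial>\<mu>)"
    unfolding kendall_conv_def using assms(2,4) m unfolding P_plus_eq
    by (intro emeasure_bind_prob_algebra)
  also have "\<dots> = (\<integral>\<^sup>+x. \<integral>\<^sup>+y. emeasure (kendall_dirac \<alpha> x y) A \<partial>\<nu> \<partial>\<mu>)"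
  proof (intro nn_integral_cong)
    fix x assume "x \<in> space \<mu>"
    then have "x \<in> space half_line"
      using assms(2) sets_eq_imp_space_eq[of \<mu> half_line] by (simp add: P_plus_def)
    from measurable_Pair2[OF measurable_kendall_dirac[OF assms(1)] this]
    have "kendall_dirac \<alpha> x \<in> measurable half_line (prob_algebra half_line)" by simp
    then show "emeasure (\<nu> \<bind> (\<lambda>y. kendall_dirac \<alpha> x y)) A = (\<integral>\<^sup>+y. emeasure (kendall_dirac \<alpha> x y) A \<partial>\<nu>)"
      using assms(3,4) unfolding P_plus_eq by (intro emeasure_bind_prob_algebra)
  qed
  finally show ?thesis .
qed

lemma kendall_dirac_0:
  assumes "\<alpha> > 0" "0 \<le> y"
  shows "kendall_dirac \<alpha> 0 y = return half_line y"
proof (cases "y = 0")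
  case True
  then show ?thesis by (simp add: kendall_dirac_def)
next
  case False
  show ?thesis
  proof (rule measure_eqI)
    fix A assume "A \<in> sets (kendall_dirac \<alpha> 0 y)"
    then show "emeasure (kendall_dirac \<alpha> 0 y) A = emeasure (return half_line y) A"
      using False assms by (subst emeasure_kendall_dirac) auto
  qed simp
qed

lemma kendall_power_1:
  assumes "\<alpha> > 0" "\<nu> \<in> P_plus"
  shows "kendall_power \<alpha> \<nu> 1 = \<nu>"
proof -
  have d0: "return half_line 0 \<in> P_plus"
    by (simp add: P_plus_def prob_space_return)
  have s: "sets \<nu> = sets half_line" and sp: "space \<nu> = {0..}"
    using assms sets_eq_imp_space_eq[of \<nu> half_line] by (auto simp: P_plus_def)
  have "kendall_conv \<alpha> (return half_line 0) \<nu> = \<nu> \<bind> (\<lambda>y. kendall_dirac \<alpha> 0 y)"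
    unfolding kendall_conv_def
    by (rule bind_return[where N = half_line])
       (use measurable_kendall_dirac_section[OF assms] in \<open>auto intro: measurable_prob_algebraD\<close>)
  also have "\<dots> = \<nu> \<bind> return \<nu>"
    using assms(1) sp return_sets_cong[OF s]
    by (intro bind_cong) (auto simp: kendall_dirac_0)
  also have "\<dots> = \<nu>"
    by (rule bind_return'')  (rule refl)
  finally show ?thesis by simp
qed

end

theory Submission
  imports Defs
begin

text \<open>
  For fixed \<open>t > 0\<close> put \<open>p x = (1 - x\<^sup>\<alpha>/t\<^sup>\<alpha>)\<^sub>+\<close> and \<open>d x = x\<^sup>\<alpha>/t\<^sup>\<alpha>\<close> on \<open>[0,t]\<close>, \<open>d x = 0\<close> elsewhere. Then \<open>G\<close> (the
  Williamson transform) and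
  \<open>F - G = t\<^sup>-\<^sup>\<alpha> H\<close> are the integrals of \<open>p\<close> and \<open>d\<close>. The Kendall convolution of the point masses at
  \<open>x\<close> and \<open>y\<close> integrates \<open>p\<close> to \<open>p x p y\<close>, and it gives \<open>[0,t]\<close> the mass \<open>p x 1(y \<le> t) + d x p y\<close>.
  Hence \<open>G\<close> is multiplicative, and the distribution function of a convolution of two laws is
  \<open>G\<^sub>1 F\<^sub>2 + (F\<^sub>1 - G\<^sub>1) G\<^sub>2\<close>, from which the formula for \<open>F\<^sub>n\<close> follows by induction. For the renewal
  process, a step from \<open>x > t\<close> never ends in \<open>[0,t]\<close>, so almost surely \<open>S\<^sub>n\<^sub>+\<^sub>1 \<le> t\<close> implies
  \<open>S\<^sub>n \<le> t\<close>. Therefore \<open>P{N(t) = n} = F\<^sub>n(t) - F\<^sub>n\<^sub>+\<^sub>1(t)\<close>.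
\<close>

section \<open>Integration against the Pareto law and the Kendall kernel\<close>

lemma nn_integral_pareto:
  assumes "f \<in> borel_measurable half_line"
  shows "(\<integral>\<^sup>+y. f y \<partial>pareto \<beta>) =
    (\<integral>\<^sup>+y. ennreal (\<beta> * y powr (- \<beta> - 1)) * indicator {1..} y * f y \<partial>lborel)"
proof -
  have s: "sets (restrict_space lborel {0::real..}) = sets half_line"
    by (simp add: half_line_def sets_restrict_space)
  have d: "(\<lambda>y. ennreal (\<beta> * y powr (- \<beta> - 1)) * indicator {1..} y)
      \<in> borel_measurable (restrict_space lborel {0..})"
    by (intro measurable_restrict_space1) measurable
  have f: "f \<in> borel_measurable (restrict_space lborel {0..})"
    using assms by (simp add: measurable_cong_sets[OF s refl])
  have "(\<integral>\<^sup>+y. f y \<partial>pareto \<beta>) = (\<integral>\<^sup>+y. ennreal (\<beta> * y powr (- \<beta> - 1)) * indicator {1..} y * f y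
      \<partial>restrict_space lborel {0..})"
    unfolding pareto_def by (rule nn_integral_density[OF d f])
  also have "\<dots> = (\<integral>\<^sup>+y. ennreal (\<beta> * y powr (- \<beta> - 1)) * indicator {1..} y * f y \<partial>lborel)"
    by (subst nn_integral_restrict_space) (auto simp: indicator_def intro!: nn_integral_cong)
  finally show ?thesis .
qed

text \<open>\<open>kendall_unit\<close> is specified through its values on sets, so the formula is
  first known for indicators; the standard induction over nonnegative measurable functions carries
  it to integrals.\<close>

lemma nn_integral_kendall_unit:
  assumes "f \<in> borel_measurable half_line"
  shows "(\<integral>\<^sup>+y. f y \<partial>kendall_unit \<alpha> x) =
    ennreal (1 - x powr \<alpha>) * f 1 + ennreal (x powr \<alpha>) * (\<integral>\<^sup>+y. f y \<partial>pareto (2 * \<alpha>))"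
  using assms
proof (induction rule: borel_measurable_induct)
  case (cong f g)
  then have "(\<integral>\<^sup>+y. f y \<partial>kendall_unit \<alpha> x) = (\<integral>\<^sup>+y. g y \<partial>kendall_unit \<alpha> x)"
    "(\<integral>\<^sup>+y. f y \<partial>pareto (2 * \<alpha>)) = (\<integral>\<^sup>+y. g y \<partial>pareto (2 * \<alpha>))"
    by (intro nn_integral_cong; simp)+
  with cong show ?case by simp
next
  case (set A)
  then show ?case by (simp add: emeasure_kendall_unit)
next
  case (mult u c)
  then have "u \<in> borel_measurable (kendall_unit \<alpha> x)" "u \<in> borel_measurable (pareto (2 * \<alpha>))"
    by (simp_all cong: measurable_cong_sets)
  with mult show ?case by (simp add: nn_integral_cmult distrib_left mult_ac)
next
  case (add u v)
  then have "u \<in> borel_measurable (kendall_unit \<alpha> x)" "u \<in> borel_measurable (pareto (2 * \<alpha>))"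
    "v \<in> borel_measurable (kendall_unit \<alpha> x)" "v \<in> borel_measurable (pareto (2 * \<alpha>))"
    by (simp_all cong: measurable_cong_sets)
  with add show ?case by (simp add: nn_integral_add distrib_left add_ac)
next
  case (seq U)
  have m: "U i \<in> borel_measurable (kendall_unit \<alpha> x)" "U i \<in> borel_measurable (pareto (2 * \<alpha>))" for i
    using seq(1)[of i] by (simp_all cong: measurable_cong_sets)
  have inc: "incseq (\<lambda>i. \<integral>\<^sup>+y. U i y \<partial>pareto (2 * \<alpha>))" "incseq (\<lambda>i. U i 1)"
    using \<open>incseq U\<close> by (auto simp: incseq_def le_fun_def intro!: nn_integral_mono)
  have "(\<integral>\<^sup>+y. (SUP i. U i) y \<partial>kendall_unit \<alpha> x) = (SUP i. \<integral>\<^sup>+y. U i y \<partial>kendall_unit \<alpha> x)"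
    using nn_integral_monotone_convergence_SUP[OF \<open>incseq U\<close> m(1)] by (simp add: image_comp)
  also have "\<dots> = (SUP i. ennreal (1 - x powr \<alpha>) * U i 1
      + ennreal (x powr \<alpha>) * (\<integral>\<^sup>+y. U i y \<partial>pareto (2 * \<alpha>)))"
    by (simp add: seq)
  also have "\<dots> = (SUP i. ennreal (1 - x powr \<alpha>) * U i 1)
      + (SUP i. ennreal (x powr \<alpha>) * (\<integral>\<^sup>+y. U i y \<partial>pareto (2 * \<alpha>)))"
    using inc by (intro ennreal_SUP_add) (auto simp: incseq_def intro!: mult_left_mono)
  also have "\<dots> = ennreal (1 - x powr \<alpha>) * (SUP i. U i 1)
      + ennreal (x powr \<alpha>) * (SUP i. \<integral>\<^sup>+y. U i y \<partial>pareto (2 * \<alpha>))"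
    by (simp add: SUP_mult_left_ennreal)
  also have "(SUP i. \<integral>\<^sup>+y. U i y \<partial>pareto (2 * \<alpha>)) = (\<integral>\<^sup>+y. (SUP i. U i) y \<partial>pareto (2 * \<alpha>))"
    using nn_integral_monotone_convergence_SUP[OF \<open>incseq U\<close> m(2)] by (simp add: image_comp)
  finally show ?case by (simp add: image_comp)
qed

lemma nn_integral_kendall_dirac:
  assumes "0 \<le> x" "0 \<le> y" "max x y > 0" and f: "f \<in> borel_measurable half_line"
  shows "(\<integral>\<^sup>+z. f z \<partial>kendall_dirac \<alpha> x y) =
    ennreal (1 - (min x y / max x y) powr \<alpha>) * f (max x y)
    + ennreal ((min x y / max x y) powr \<alpha>) * (\<integral>\<^sup>+z. f (max x y * z) \<partial>pareto (2 * \<alpha>))"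
proof -
  have s: "(\<lambda>z. max x y * z) \<in> measurable half_line half_line"
    using assms by (intro measurable_scale_half_line) simp
  then have "(\<integral>\<^sup>+z. f z \<partial>kendall_dirac \<alpha> x y) =
      (\<integral>\<^sup>+z. f (max x y * z) \<partial>kendall_unit \<alpha> (min x y / max x y))"
    using assms unfolding kendall_dirac_def
    by (simp add: nn_integral_distr measurable_cong_sets[OF sets_kendall_unit refl])
  then show ?thesis
    using measurable_compose[OF s f] by (simp add: nn_integral_kendall_unit)
qed

section \<open>Explicit integrals for the convolution of two point masses\<close>

lemma nn_integral_pareto_indicator:
  assumes "\<beta> > 0" "T \<ge> 1"
  shows "(\<integral>\<^sup>+z. indicator {0..T} z \<partial>pareto \<beta>) = ennreal (1 - T powr (- \<beta>))"
proof -
  have "(\<integral>\<^sup>+z. indicator {0..T} z \<partial>pareto \<beta>) =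
      (\<integral>\<^sup>+z. ennreal (\<beta> * z powr (- \<beta> - 1)) * indicator {1..T} z \<partial>lborel)"
    by (subst nn_integral_pareto)
      (auto simp: indicator_def intro!: borel_measurable_half_line nn_integral_cong)
  also have "\<dots> = ennreal (- (T powr (- \<beta>)) - (- (1 powr (- \<beta>))))"
  proof (rule nn_integral_FTC_Icc)
    show "DERIV (\<lambda>z. - (z powr (- \<beta>))) z :> \<beta> * z powr (- \<beta> - 1)" if "z \<in> {1..T}" for z
      using that by (auto intro!: derivative_eq_intros simp: powr_diff)
  qed (use assms in simp_all)
  finally show ?thesis by simp
qed

text \<open>The density starts at 1 and the positive part vanishes beyond \<open>T\<close>, so the
  integral runs over \<open>{1..T}\<close>, where \<open>?F\<close> is an antiderivative. With s =
  \<open>T powr (- \<alpha>)\<close> its increment is s^2 - (2 s - 1) = (1 - s)^2.\<close>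

lemma nn_integral_pareto_Williamson:
  assumes "\<alpha> > 0" "T \<ge> 1"
  shows "(\<integral>\<^sup>+z. ennreal (max (1 - z powr \<alpha> / T powr \<alpha>) 0) \<partial>pareto (2 * \<alpha>)) =
    ennreal ((1 - T powr (- \<alpha>))\<^sup>2)"
proof -
  let ?f = "\<lambda>z. 2 * \<alpha> * z powr (- (2 * \<alpha>) - 1) * (1 - z powr \<alpha> / T powr \<alpha>)"
  let ?F = "\<lambda>z. - (z powr (- (2 * \<alpha>))) + 2 * z powr (- \<alpha>) / T powr \<alpha>"
  have le: "z powr \<alpha> \<le> T powr \<alpha> \<longleftrightarrow> z \<le> T" if "1 \<le> z" for z
    using assms that powr_mono2[of \<alpha> z T] powr_less_mono2[of \<alpha> T z] by force
  have ge: "T powr \<alpha> \<le> z powr \<alpha>" if "T < z" for z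
    using assms that by (simp add: powr_mono2)
  have "(\<integral>\<^sup>+z. ennreal (max (1 - z powr \<alpha> / T powr \<alpha>) 0) \<partial>pareto (2 * \<alpha>)) =
      (\<integral>\<^sup>+z. ennreal (?f z) * indicator {1..T} z \<partial>lborel)"
  proof (subst nn_integral_pareto)
    show "(\<lambda>z. ennreal (max (1 - z powr \<alpha> / T powr \<alpha>) 0)) \<in> borel_measurable half_line"
      by (rule borel_measurable_half_line) measurable
    show "(\<integral>\<^sup>+z. ennreal (2 * \<alpha> * z powr (- (2 * \<alpha>) - 1)) * indicator {1..} z *
        ennreal (max (1 - z powr \<alpha> / T powr \<alpha>) 0) \<partial>lborel) =
      (\<integral>\<^sup>+z. ennreal (?f z) * indicator {1..T} z \<partial>lborel)"
      using assms le
      by (intro nn_integral_cong)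
        (auto simp: indicator_def ennreal_mult'[symmetric] not_le ge intro!: ennreal_neg)
  qed
  also have "\<dots> = ennreal (?F T - ?F 1)"
  proof (rule nn_integral_FTC_Icc)
    show "DERIV ?F z :> ?f z" if "z \<in> {1..T}" for z
      using that
      by (auto intro!: derivative_eq_intros simp: powr_diff powr_minus powr_mult_base field_simps powr_add[symmetric])
    show "0 \<le> ?f z" if "z \<in> {1..T}" for z
      using assms that le by (auto simp: divide_simps)
  qed (use assms in auto)
  also have "?F T - ?F 1 = (1 - T powr (- \<alpha>))\<^sup>2"
    using assms
    by (simp add: power2_eq_square powr_minus field_simps powr_add[symmetric])
  finally show ?thesis .
qed

lemma kendall_dirac_commute: "kendall_dirac \<alpha> x y = kendall_dirac \<alpha> y x"
  unfolding kendall_dirac_def max.commute[of x y] min.commute[of x y] ..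

text \<open>For \<open>x \<le> y\<close> and \<open>y > 0\<close>, with \<open>a\<close> and
  \<open>b\<close> as in the proof, the law mixes the point mass at \<open>y\<close> (weight 1 -
  a/b) and the Pareto law scaled by \<open>y\<close> (weight a/b). These integrate the function to
  (1 - b)_+ and its square, and the mixture simplifies to (1 - a)_+ (1 - b)_+.\<close>

lemma nn_integral_kendall_dirac_Williamson:
  assumes "\<alpha> > 0" "t > 0" "0 \<le> x" "0 \<le> y"
  shows "(\<integral>\<^sup>+z. ennreal (max (1 - z powr \<alpha> / t powr \<alpha>) 0) \<partial>kendall_dirac \<alpha> x y) =
    ennreal (max (1 - x powr \<alpha> / t powr \<alpha>) 0) * ennreal (max (1 - y powr \<alpha> / t powr \<alpha>) 0)"
  using assms(3,4)
\<comment> \<open>Both sides are symmetric, so \<open>x \<le> y\<close> may be assumed; the scaling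
  factor is then \<open>y\<close>.\<close>
proof (induction x y rule: linorder_wlog)
  case (sym x y)
  then show ?case by (simp add: kendall_dirac_commute[of \<alpha> x y] mult.commute)
next
  case (le x y)
  let ?p = "\<lambda>z. ennreal (max (1 - z powr \<alpha> / t powr \<alpha>) 0)"
  have p: "?p \<in> borel_measurable half_line"
    by (rule borel_measurable_half_line) measurable
  show ?case
  \<comment> \<open>If \<open>y = 0\<close>, then also \<open>x = 0\<close> and the law is the point
    mass at 0. The ratio a/b is meaningful only in the other case.\<close>
  proof (cases "y = 0")
    case True
    with le p assms show ?thesis
      by (simp add: kendall_dirac_def nn_integral_return)
  next
    case False
    with le have y: "y > 0" by simp
    define a b where "a = x powr \<alpha> / t powr \<alpha>" and "b = y powr \<alpha> / t powr \<alpha>"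
    have ab: "0 \<le> a" "a \<le> b" "0 < b"
      using le assms y by (auto simp: a_def b_def divide_right_mono powr_mono2)
    have r: "(x / y) powr \<alpha> = a / b"
      using le y assms by (simp add: a_def b_def powr_divide)
    have eq: "(\<integral>\<^sup>+z. ?p z \<partial>kendall_dirac \<alpha> x y) =
        ennreal (1 - a / b) * ?p y + ennreal (a / b) * (\<integral>\<^sup>+z. ?p (y * z) \<partial>pareto (2 * \<alpha>))"
      using nn_integral_kendall_dirac[of x y ?p \<alpha>, OF _ _ _ p] le y
      by (simp add: r max_absorb2 min_absorb1)
    have scale: "(y * z) powr \<alpha> / t powr \<alpha> = z powr \<alpha> / (t / y) powr \<alpha>" if "0 \<le> z" for z
      using y assms that by (simp add: powr_mult powr_divide)
    have unscale: "(\<integral>\<^sup>+z. ?p (y * z) \<partial>pareto (2 * \<alpha>)) =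
        (\<integral>\<^sup>+z. ennreal (max (1 - z powr \<alpha> / (t / y) powr \<alpha>) 0) \<partial>pareto (2 * \<alpha>))"
      using scale by (intro nn_integral_cong) simp
    have I: "(\<integral>\<^sup>+z. ?p (y * z) \<partial>pareto (2 * \<alpha>)) = ennreal ((max (1 - b) 0)\<^sup>2)"
    proof (cases "y \<le> t")
      case True
      then have "b \<le> 1" using y assms by (simp add: b_def powr_mono2)
      moreover have "(t / y) powr (- \<alpha>) = b"
        using y assms by (simp add: b_def powr_minus powr_divide)
      ultimately show ?thesis
        using nn_integral_pareto_Williamson[of \<alpha> "t / y"] True y assms unfolding unscale by simp
    next
      \<comment> \<open>Scaled by \<open>y > t\<close>, the Pareto law lives beyond
        \<open>t\<close>, where the integrand is 0; and \<open>max (1 - b) 0\<close> is 0 as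
        well.\<close>
      case False
      then have "1 \<le> b" using y assms by (simp add: b_def powr_mono2)
      have ge: "1 \<le> z powr \<alpha> / (t / y) powr \<alpha>" if "1 \<le> z" for z
      proof -
        have "1 * 1 \<le> b * z powr \<alpha>"
          using that assms \<open>1 \<le> b\<close> by (intro mult_mono) (simp_all add: ge_one_powr_ge_zero)
        also have "b * z powr \<alpha> = z powr \<alpha> / (t / y) powr \<alpha>"
          using y assms by (simp add: b_def powr_divide)
        finally show ?thesis by simp
      qed
      have "(\<integral>\<^sup>+z. ennreal (max (1 - z powr \<alpha> / (t / y) powr \<alpha>) 0) \<partial>pareto (2 * \<alpha>)) = 0"
      proof (subst nn_integral_pareto)
        show "(\<lambda>z. ennreal (max (1 - z powr \<alpha> / (t / y) powr \<alpha>) 0)) \<in> borel_measurable half_line"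
          by (rule borel_measurable_half_line) measurable
        have "indicator {1..} z * ennreal (max (1 - z powr \<alpha> / (t / y) powr \<alpha>) 0) = 0" for z
          using ge[of z] by (cases "1 \<le> z") (simp_all add: ennreal_neg del: powr_divide)
        then show "(\<integral>\<^sup>+z. ennreal (2 * \<alpha> * z powr (- (2 * \<alpha>) - 1)) * indicator {1..} z *
            ennreal (max (1 - z powr \<alpha> / (t / y) powr \<alpha>) 0) \<partial>lborel) = 0"
          by (simp only: mult.assoc mult_zero_right nn_integral_const mult_zero_left)
      qed
      with \<open>1 \<le> b\<close> show ?thesis
        unfolding unscale by (simp only: max_absorb2 diff_le_0_iff_le power_zero_numeral ennreal_0)
    qed
    \<comment> \<open>For \<open>b > 1\<close> both sides are 0. Otherwise the polynomial identity
      in \<open>c\<close> is applied to \<open>c = a / b\<close>, so that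
      \<open>c * b = a\<close>.\<close>
    have "(1 - a / b) * max (1 - b) 0 + a / b * (max (1 - b) 0)\<^sup>2 = max (1 - a) 0 * max (1 - b) 0"
    proof (cases "b \<le> 1")
      case True
      have "(1 - c) * (1 - b) + c * (1 - b)\<^sup>2 = (1 - c * b) * (1 - b)" for c
        by (simp add: power2_eq_square algebra_simps)
      from this[of "a / b"] True ab show ?thesis by simp
    qed (simp add: max_absorb2)
    moreover have "0 \<le> 1 - a / b" "0 \<le> a / b"
      using ab by simp_all
    ultimately show ?thesis
      unfolding eq I a_def[symmetric] b_def[symmetric]
      by (subst (1 2 3) ennreal_mult''[symmetric], simp, simp, simp, subst ennreal_plus[symmetric])
        (use ab in auto)
  qed
qed

text \<open>The law lives on values at least \<open>max x y\<close>, which explains the indicators.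
  For \<open>x \<le> y \<le> t\<close> and \<open>y > 0\<close> the point mass contributes 1 - a/b
  and the scaled Pareto law (a/b)(1 - b^2); the sum is 1 - a b.\<close>

lemma emeasure_kendall_dirac_cdf:
  assumes "\<alpha> > 0" "t > 0" "0 \<le> x" "0 \<le> y"
  shows "emeasure (kendall_dirac \<alpha> x y) {0..t} =
    ennreal (1 - x powr \<alpha> / t powr \<alpha> * (y powr \<alpha> / t powr \<alpha>)) * (indicator {0..t} x * indicator {0..t} y)"
  using assms(3,4)
proof (induction x y rule: linorder_wlog)
  case (sym x y)
  then show ?case by (simp add: kendall_dirac_commute[of \<alpha> x y] mult.commute)
next
  case (le x y)
  have s: "{0..t} \<in> sets half_line" by (simp add: sets_half_line)
  show ?case
  proof (cases "y = 0")
    case True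
    with le s assms show ?thesis
      by (simp add: kendall_dirac_def)
  next
    case False
    with le have y: "y > 0" by simp
    define a b where "a = x powr \<alpha> / t powr \<alpha>" and "b = y powr \<alpha> / t powr \<alpha>"
    have ab: "0 \<le> a" "a \<le> b" "0 < b"
      using le assms y by (auto simp: a_def b_def divide_right_mono powr_mono2)
    have r: "(x / y) powr \<alpha> = a / b"
      using le y assms by (simp add: a_def b_def powr_divide)
    have eq: "emeasure (kendall_dirac \<alpha> x y) {0..t} =
        ennreal (1 - a / b) * indicator {0..t} y
        + ennreal (a / b) * (\<integral>\<^sup>+z. indicator {0..t} (y * z) \<partial>pareto (2 * \<alpha>))"
      using emeasure_kendall_dirac[of x y "{0..t}" \<alpha>] le y s
      by (simp add: r max_absorb2 min_absorb1)
    have "indicator {0..t} (y * z) = (indicator {0..t / y} z :: ennreal)" for z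
      using y by (auto simp: indicator_def field_simps zero_le_mult_iff)
    then have "(\<integral>\<^sup>+z. indicator {0..t} (y * z) \<partial>pareto (2 * \<alpha>)) =
        (\<integral>\<^sup>+z. indicator {0..t / y} z \<partial>pareto (2 * \<alpha>))"
      by simp
    also have "\<dots> = ennreal (1 - b\<^sup>2) * indicator {0..t} y"
    proof (cases "y \<le> t")
      case True
      \<comment> \<open>The Pareto tail beyond \<open>t / y\<close> is the square of
        \<open>b\<close>.\<close>
      have "(t / y) powr (- (2 * \<alpha>)) = ((t / y) powr (- \<alpha>))\<^sup>2"
        by (simp add: power2_eq_square powr_add[symmetric])
      also have "(t / y) powr (- \<alpha>) = b"
        using y assms by (simp add: b_def powr_minus powr_divide)
      finally show ?thesis
        using nn_integral_pareto_indicator[of "2 * \<alpha>" "t / y"] True y assms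
        by simp
    next
      case False
      then have "t / y < 1" using y by simp
      with False show ?thesis
        by (subst nn_integral_pareto)
          (auto intro!: borel_measurable_half_line nn_integral_zero' AE_I2 simp: indicator_def)
    qed
    finally have I: "(\<integral>\<^sup>+z. indicator {0..t} (y * z) \<partial>pareto (2 * \<alpha>)) = ennreal (1 - b\<^sup>2) * indicator {0..t} y" .
    show ?thesis
    proof (cases "y \<le> t")
      case True
      then have "b \<le> 1" using y assms by (simp add: b_def powr_mono2)
      then have "b\<^sup>2 \<le> 1" using ab by (simp add: power_le_one)
      then have "ennreal (1 - a / b) + ennreal (a / b) * ennreal (1 - b\<^sup>2) =
          ennreal ((1 - a / b) + a / b * (1 - b\<^sup>2))"
        using ab by (subst ennreal_plus) (simp_all add: ennreal_mult[symmetric])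
      also have "(1 - a / b) + a / b * (1 - b\<^sup>2) = 1 - a * b"
        using ab by (simp add: power2_eq_square field_simps)
      finally show ?thesis
        using True le unfolding eq I a_def[symmetric] b_def[symmetric] by simp
    next
      case False
      then show ?thesis unfolding eq I by simp
    qed
  qed
qed

section \<open>The convolution as a transition kernel on the half-line\<close>

lemma P_plus_sets: "\<nu> \<in> P_plus \<Longrightarrow> sets \<nu> = sets half_line"
  and P_plus_space: "\<nu> \<in> P_plus \<Longrightarrow> space \<nu> = {0..}"
  and P_plus_prob_space: "\<nu> \<in> P_plus \<Longrightarrow> prob_space \<nu>"
  using sets_eq_imp_space_eq[of \<nu> half_line] by (auto simp: P_plus_def)

lemma borel_measurable_P_plus:
  "\<nu> \<in> P_plus \<Longrightarrow> f \<in> borel_measurable borel \<Longrightarrow> f \<in> borel_measurable \<nu>"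
  unfolding measurable_cong_sets[OF P_plus_sets refl] by (rule borel_measurable_half_line)

lemma return_P_plus: "0 \<le> x \<Longrightarrow> return half_line x \<in> P_plus"
  by (simp add: P_plus_def prob_space_return)

lemma measurable_kendall_dirac_Pair2:
  assumes "\<alpha> > 0" "0 \<le> x"
  shows "kendall_dirac \<alpha> x \<in> measurable half_line (prob_algebra half_line)"
  using measurable_Pair2[OF measurable_kendall_dirac[OF assms(1)], of x] assms by simp

lemma nn_integral_kendall_conv:
  assumes "\<alpha> > 0" "\<mu> \<in> P_plus" "\<nu> \<in> P_plus" and f: "f \<in> borel_measurable half_line"
  shows "(\<integral>\<^sup>+z. f z \<partial>kendall_conv \<alpha> \<mu> \<nu>) = (\<integral>\<^sup>+x. \<integral>\<^sup>+y. \<integral>\<^sup>+z. f z \<partial>kendall_dirac \<alpha> x y \<partial>\<nu> \<partial>\<mu>)"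
proof -
  have "(\<integral>\<^sup>+z. f z \<partial>kendall_conv \<alpha> \<mu> \<nu>) = (\<integral>\<^sup>+x. \<integral>\<^sup>+z. f z \<partial>(\<nu> \<bind> kendall_dirac \<alpha> x) \<partial>\<mu>)"
    unfolding kendall_conv_def using measurable_kendall_dirac_section[OF assms(1,3)]
    by (intro nn_integral_bind[OF f])
      (simp add: measurable_cong_sets[OF P_plus_sets[OF assms(2)] refl] measurable_prob_algebraD)
  also have "\<dots> = (\<integral>\<^sup>+x. \<integral>\<^sup>+y. \<integral>\<^sup>+z. f z \<partial>kendall_dirac \<alpha> x y \<partial>\<nu> \<partial>\<mu>)"
    using P_plus_space[OF assms(2)] measurable_kendall_dirac_Pair2[OF assms(1)]
    by (intro nn_integral_cong nn_integral_bind[OF f])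
      (simp add: measurable_cong_sets[OF P_plus_sets[OF assms(3)] refl] measurable_prob_algebraD)
  finally show ?thesis .
qed

text \<open>The assumption \<open>transition\<close> has a point mass as first factor; this reduces
  such a law to a single bind over the step distribution.\<close>

lemma kendall_conv_return:
  assumes "\<alpha> > 0" "\<nu> \<in> P_plus" "0 \<le> x"
  shows "kendall_conv \<alpha> (return half_line x) \<nu> = \<nu> \<bind> kendall_dirac \<alpha> x"
  unfolding kendall_conv_def using assms measurable_kendall_dirac_section[OF assms(1,2)]
  by (subst bind_return[where N = half_line]) (auto intro: measurable_prob_algebraD)

text \<open>Convolving with \<open>\<nu>\<close> averages the one-step kernel of the walk over the
  current law, which is how the law of the next position arises in \<open>distr_S\<close>.\<close>

lemma kendall_conv_bind_return:
  assumes "\<alpha> > 0" "\<mu> \<in> P_plus" "\<nu> \<in> P_plus"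
  shows "kendall_conv \<alpha> \<mu> \<nu> = \<mu> \<bind> (\<lambda>x. kendall_conv \<alpha> (return half_line x) \<nu>)"
  unfolding kendall_conv_def[of \<alpha> \<mu> \<nu>] using assms
  by (intro bind_cong refl) (simp add: kendall_conv_return P_plus_space[OF assms(2)])

lemma measurable_kendall_conv_return:
  assumes "\<alpha> > 0" "\<nu> \<in> P_plus"
  shows "(\<lambda>x. kendall_conv \<alpha> (return half_line x) \<nu>) \<in> measurable half_line (prob_algebra half_line)"
  using measurable_kendall_dirac_section[OF assms]
  by (rule measurable_cong[THEN iffD2, rotated]) (simp add: kendall_conv_return[OF assms])

text \<open>The mass of \<open>{0..t}\<close> under \<open>kendall_dirac \<alpha> x y\<close>
  carries the factor \<open>indicator {0..t} x\<close>, which is 0 here. This is why the walk does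
  not come back below a level once exceeded.\<close>

lemma kendall_conv_return_cdf_eq_0:
  assumes "\<alpha> > 0" "\<nu> \<in> P_plus" "0 < t" "t < x"
  shows "measure (kendall_conv \<alpha> (return half_line x) \<nu>) {0..t} = 0"
proof -
  have "emeasure (kendall_conv \<alpha> (return half_line x) \<nu>) {0..t} =
      (\<integral>\<^sup>+y. emeasure (kendall_dirac \<alpha> x y) {0..t} \<partial>\<nu>)"
    using assms measurable_kendall_dirac_Pair2[of \<alpha> x] kendall_conv_return[of \<alpha> \<nu> x]
    by (simp add: emeasure_bind_prob_algebra P_plus_eq sets_half_line)
  also have "\<dots> = (\<integral>\<^sup>+y. 0 \<partial>\<nu>)"
    using assms P_plus_space[OF assms(2)]
    by (intro nn_integral_cong) (simp add: emeasure_kendall_dirac_cdf)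
  finally show ?thesis by (simp add: measure_def)
qed

section \<open>Williamson transform, truncated moment and distribution function\<close>

lemma integrable_Williamson:
  assumes "t > 0" "\<nu> \<in> P_plus"
  shows "integrable \<nu> (\<lambda>x. max (1 - x powr \<alpha> / t powr \<alpha>) 0)"
proof -
  interpret prob_space \<nu> using assms(2) by (rule P_plus_prob_space)
  show ?thesis
    using assms by (intro integrable_const_bound[of _ 1] borel_measurable_P_plus[OF assms(2)]) auto
qed

text \<open>Here and in \<open>nn_integral_truncated_moment\<close> the Bochner integrals behind G
  and H become nonnegative integrals, in which the iterated integrals over the kernel are
  computed.\<close>

lemma nn_integral_Williamson:
  assumes "t > 0" "\<nu> \<in> P_plus"
  shows "(\<integral>\<^sup>+x. ennreal (max (1 - x powr \<alpha> / t powr \<alpha>) 0) \<partial>\<nu>) = ennreal (kendall_G \<alpha> \<nu> t)"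
  unfolding kendall_G_def using integrable_Williamson[OF assms]
  by (intro nn_integral_eq_integral) auto

lemma kendall_G_nonneg: "0 \<le> kendall_G \<alpha> \<nu> t"
  unfolding kendall_G_def by (intro integral_nonneg_AE) simp

lemma kendall_H_nonneg: "0 \<le> kendall_H \<alpha> \<nu> t"
  unfolding kendall_H_def set_lebesgue_integral_def by (intro integral_nonneg_AE) simp

lemma integrable_truncated_moment:
  assumes "\<alpha> > 0" "t > 0" "\<nu> \<in> P_plus"
  shows "set_integrable \<nu> {0..t} (\<lambda>x. x powr \<alpha>)"
proof -
  interpret prob_space \<nu> using assms(3) by (rule P_plus_prob_space)
  show ?thesis
    unfolding set_integrable_def using assms
    by (intro integrable_const_bound[of _ "t powr \<alpha>"] borel_measurable_P_plus[OF assms(3)])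
      (auto simp: indicator_def powr_mono2)
qed

lemma nn_integral_truncated_moment:
  assumes "\<alpha> > 0" "t > 0" "\<nu> \<in> P_plus"
  shows "(\<integral>\<^sup>+x. ennreal (x powr \<alpha> / t powr \<alpha>) * indicator {0..t} x \<partial>\<nu>) =
    ennreal (t powr (- \<alpha>) * kendall_H \<alpha> \<nu> t)"
proof -
  have "(\<integral>\<^sup>+x. ennreal (x powr \<alpha> / t powr \<alpha>) * indicator {0..t} x \<partial>\<nu>) =
      (\<integral>\<^sup>+x. ennreal (t powr (- \<alpha>) * (indicator {0..t} x *\<^sub>R x powr \<alpha>)) \<partial>\<nu>)"
    by (intro nn_integral_cong) (auto simp: indicator_def powr_minus divide_inverse mult.commute)
  also have "\<dots> = ennreal (\<integral>x. t powr (- \<alpha>) * (indicator {0..t} x *\<^sub>R x powr \<alpha>) \<partial>\<nu>)"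
    using integrable_truncated_moment[OF assms] unfolding set_integrable_def
    by (intro nn_integral_eq_integral) auto
  finally show ?thesis by (simp add: kendall_H_def set_lebesgue_integral_def)
qed

text \<open>On the half-line the indicator of \<open>{0..t}\<close> is p + d: up to \<open>t\<close>
  the two functions add up to 1, and beyond \<open>t\<close> both vanish. The result links the two
  forms of the formula for F_n.\<close>

lemma cdf_plus_eq_G_plus_H:
  assumes "\<alpha> > 0" "t > 0" "\<nu> \<in> P_plus"
  shows "cdf_plus \<nu> t = kendall_G \<alpha> \<nu> t + t powr (- \<alpha>) * kendall_H \<alpha> \<nu> t"
proof -
  interpret prob_space \<nu> using assms(3) by (rule P_plus_prob_space)
  have split: "indicator {0..t} x = ennreal (max (1 - x powr \<alpha> / t powr \<alpha>) 0)
      + ennreal (x powr \<alpha> / t powr \<alpha>) * indicator {0..t} x" if "0 \<le> x" for x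
  proof (cases "x \<le> t")
    case True
    then have "x powr \<alpha> \<le> t powr \<alpha>" using assms that by (simp add: powr_mono2)
    with that True assms show ?thesis
      by (simp add: ennreal_plus[symmetric] del: ennreal_plus)
  next
    case False
    then have "t powr \<alpha> \<le> x powr \<alpha>" using assms by (simp add: powr_mono2)
    with False assms show ?thesis by (simp add: ennreal_neg)
  qed
  have "ennreal (cdf_plus \<nu> t) = (\<integral>\<^sup>+x. indicator {0..t} x \<partial>\<nu>)"
    using P_plus_sets[OF assms(3)]
    by (simp add: cdf_plus_def emeasure_eq_measure sets_half_line)
  also have "\<dots> = (\<integral>\<^sup>+x. ennreal (max (1 - x powr \<alpha> / t powr \<alpha>) 0)
      + ennreal (x powr \<alpha> / t powr \<alpha>) * indicator {0..t} x \<partial>\<nu>)"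
    using split P_plus_space[OF assms(3)] by (intro nn_integral_cong) simp
  also have "\<dots> = ennreal (kendall_G \<alpha> \<nu> t) + ennreal (t powr (- \<alpha>) * kendall_H \<alpha> \<nu> t)"
    using assms nn_integral_Williamson[of t \<nu> \<alpha>] nn_integral_truncated_moment[of \<alpha> t \<nu>]
    by (subst nn_integral_add) (auto intro!: borel_measurable_P_plus[OF assms(3)])
  finally show ?thesis
    using kendall_G_nonneg[of \<alpha> \<nu> t] kendall_H_nonneg[of \<alpha> \<nu> t]
    by (simp add: cdf_plus_def ennreal_plus[symmetric] del: ennreal_plus)
qed

text \<open>The kernel integrates \<open>?p\<close> to \<open>?p x * ?p y\<close>, so the double
  integral factorises. The transform thus plays the role that characteristic functions play for
  ordinary convolution.\<close>

lemma kendall_G_conv: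
  assumes "\<alpha> > 0" "t > 0" "\<mu> \<in> P_plus" "\<nu> \<in> P_plus"
  shows "kendall_G \<alpha> (kendall_conv \<alpha> \<mu> \<nu>) t = kendall_G \<alpha> \<mu> t * kendall_G \<alpha> \<nu> t"
proof -
  let ?p = "\<lambda>x. ennreal (max (1 - x powr \<alpha> / t powr \<alpha>) 0)"
  have p: "?p \<in> borel_measurable \<mu>" "?p \<in> borel_measurable \<nu>" "?p \<in> borel_measurable half_line"
    using assms by (auto intro!: borel_measurable_P_plus[OF assms(3)] borel_measurable_P_plus[OF assms(4)] borel_measurable_half_line)
  have "ennreal (kendall_G \<alpha> (kendall_conv \<alpha> \<mu> \<nu>) t) =
      (\<integral>\<^sup>+x. \<integral>\<^sup>+y. \<integral>\<^sup>+z. ?p z \<partial>kendall_dirac \<alpha> x y \<partial>\<nu> \<partial>\<mu>)"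
    using assms nn_integral_Williamson[OF assms(2) kendall_conv_P_plus[OF assms(1,3,4)], of \<alpha>]
      nn_integral_kendall_conv[OF assms(1,3,4) p(3)] by simp
  also have "\<dots> = (\<integral>\<^sup>+x. \<integral>\<^sup>+y. ?p x * ?p y \<partial>\<nu> \<partial>\<mu>)"
    using assms P_plus_space
    by (intro nn_integral_cong nn_integral_kendall_dirac_Williamson) auto
  also have "\<dots> = ennreal (kendall_G \<alpha> \<mu> t) * ennreal (kendall_G \<alpha> \<nu> t)"
    using assms p by (simp only: nn_integral_cmult nn_integral_multc nn_integral_Williamson)
  finally show ?thesis
    using kendall_G_nonneg by (simp add: ennreal_mult[symmetric])
qed

text \<open>On the square where \<open>x\<close> and \<open>y\<close> are at most \<open>t\<close>,
  1 - a b = (1 - a) + a (1 - b). Each summand is a function of \<open>x\<close> times a function of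
  \<open>y\<close>, so the integrals separate; the integral of \<open>d\<close> against
  \<open>\<mu>\<close> is F - G for \<open>\<mu>\<close>.\<close>

lemma cdf_plus_conv:
  assumes "\<alpha> > 0" "t > 0" "\<mu> \<in> P_plus" "\<nu> \<in> P_plus"
  shows "cdf_plus (kendall_conv \<alpha> \<mu> \<nu>) t =
    kendall_G \<alpha> \<mu> t * cdf_plus \<nu> t + (cdf_plus \<mu> t - kendall_G \<alpha> \<mu> t) * kendall_G \<alpha> \<nu> t"
proof -
  interpret C: prob_space "kendall_conv \<alpha> \<mu> \<nu>"
    by (rule P_plus_prob_space[OF kendall_conv_P_plus[OF assms(1,3,4)]])
  interpret N: prob_space \<nu> using assms(4) by (rule P_plus_prob_space)
  define p where "p = (\<lambda>x. ennreal (max (1 - x powr \<alpha> / t powr \<alpha>) 0))"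
  define d where "d = (\<lambda>x. ennreal (x powr \<alpha> / t powr \<alpha>) * indicator {0..t} x)"
  have m [measurable]: "p \<in> borel_measurable \<mu>" "p \<in> borel_measurable \<nu>" "d \<in> borel_measurable \<mu>"
    "indicator {0..t} \<in> borel_measurable \<nu>"
    unfolding p_def d_def
    by (rule borel_measurable_P_plus[OF assms(3)] borel_measurable_P_plus[OF assms(4)]; measurable)+
  have s: "{0..t} \<in> sets half_line" by (simp add: sets_half_line)
  have split: "emeasure (kendall_dirac \<alpha> x y) {0..t} = p x * indicator {0..t} y + d x * p y"
    if "0 \<le> x" "0 \<le> y" for x y
  proof -
    define a b where "a = x powr \<alpha> / t powr \<alpha>" and "b = y powr \<alpha> / t powr \<alpha>"
    have "0 \<le> a" "0 \<le> b" by (simp_all add: a_def b_def)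
    have a: "a \<le> 1 \<longleftrightarrow> x \<le> t" and b: "b \<le> 1 \<longleftrightarrow> y \<le> t"
      using assms that powr_mono2[of \<alpha> x t] powr_less_mono2[of \<alpha> t x]
        powr_mono2[of \<alpha> y t] powr_less_mono2[of \<alpha> t y]
      by (force simp: a_def b_def)+
    have "ennreal (1 - a * b) = ennreal (1 - a) + ennreal a * ennreal (1 - b)"
      if "a \<le> 1" "b \<le> 1"
    proof -
      have "1 - a * b = (1 - a) + a * (1 - b)" by (simp add: algebra_simps)
      also have "ennreal \<dots> = ennreal (1 - a) + ennreal a * ennreal (1 - b)"
        using that \<open>0 \<le> a\<close> by (subst ennreal_plus) (simp_all add: ennreal_mult'')
      finally show ?thesis .
    qed
    \<comment> \<open>Off the square both sides vanish: \<open>p x = d x = 0\<close> for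
      \<open>x > t\<close>, and \<open>indicator {0..t} y = p y = 0\<close> for
      \<open>y > t\<close>.\<close>
    then show ?thesis
      using a b that assms unfolding emeasure_kendall_dirac_cdf[OF assms(1,2) that]
      unfolding p_def d_def a_def[symmetric] b_def[symmetric]
      by (auto simp: indicator_def ennreal_neg)
  qed
  have "ennreal (cdf_plus (kendall_conv \<alpha> \<mu> \<nu>) t) =
      (\<integral>\<^sup>+x. \<integral>\<^sup>+y. emeasure (kendall_dirac \<alpha> x y) {0..t} \<partial>\<nu> \<partial>\<mu>)"
    using emeasure_kendall_conv[OF assms(1,3,4) s]
    by (simp add: cdf_plus_def C.emeasure_eq_measure)
  also have "\<dots> = (\<integral>\<^sup>+x. \<integral>\<^sup>+y. p x * indicator {0..t} y + d x * p y \<partial>\<nu> \<partial>\<mu>)"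
    using assms P_plus_space split by (intro nn_integral_cong) auto
  also have "\<dots> = (\<integral>\<^sup>+x. p x * (\<integral>\<^sup>+y. indicator {0..t} y \<partial>\<nu>) + d x * (\<integral>\<^sup>+y. p y \<partial>\<nu>) \<partial>\<mu>)"
    by (intro nn_integral_cong) (simp add: nn_integral_add nn_integral_cmult)
  also have "\<dots> = (\<integral>\<^sup>+x. p x \<partial>\<mu>) * (\<integral>\<^sup>+y. indicator {0..t} y \<partial>\<nu>) + (\<integral>\<^sup>+x. d x \<partial>\<mu>) * (\<integral>\<^sup>+y. p y \<partial>\<nu>)"
    by (simp add: nn_integral_add nn_integral_multc)
  also have "(\<integral>\<^sup>+y. indicator {0..t} y \<partial>\<nu>) = ennreal (cdf_plus \<nu> t)"
    using s P_plus_sets[OF assms(4)] by (simp add: cdf_plus_def N.emeasure_eq_measure)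
  also have "(\<integral>\<^sup>+x. p x \<partial>\<mu>) = ennreal (kendall_G \<alpha> \<mu> t)"
    unfolding p_def by (rule nn_integral_Williamson[OF assms(2,3)])
  also have "(\<integral>\<^sup>+x. p x \<partial>\<nu>) = ennreal (kendall_G \<alpha> \<nu> t)"
    unfolding p_def by (rule nn_integral_Williamson[OF assms(2,4)])
  also have "(\<integral>\<^sup>+x. d x \<partial>\<mu>) = ennreal (t powr (- \<alpha>) * kendall_H \<alpha> \<mu> t)"
    unfolding d_def by (rule nn_integral_truncated_moment[OF assms(1-3)])
  finally have "cdf_plus (kendall_conv \<alpha> \<mu> \<nu>) t =
      kendall_G \<alpha> \<mu> t * cdf_plus \<nu> t + t powr (- \<alpha>) * kendall_H \<alpha> \<mu> t * kendall_G \<alpha> \<nu> t"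
    using kendall_G_nonneg[of \<alpha> _ t] kendall_H_nonneg[of \<alpha> _ t]
    by (simp add: cdf_plus_def ennreal_mult''[symmetric] ennreal_plus[symmetric] del: ennreal_plus)
  then show ?thesis
    using cdf_plus_eq_G_plus_H[OF assms(1-3)] by simp
qed

section \<open>Convolution powers\<close>

lemma kendall_power_P_plus: "\<alpha> > 0 \<Longrightarrow> \<nu> \<in> P_plus \<Longrightarrow> kendall_power \<alpha> \<nu> n \<in> P_plus"
  by (induction n) (auto intro: return_P_plus kendall_conv_P_plus)

lemma kendall_G_power:
  assumes "\<alpha> > 0" "t > 0" "\<nu> \<in> P_plus"
  shows "kendall_G \<alpha> (kendall_power \<alpha> \<nu> n) t = kendall_G \<alpha> \<nu> t ^ n"
proof (induction n)
  case 0
  have "(\<lambda>x. max (1 - x powr \<alpha> / t powr \<alpha>) 0) \<in> borel_measurable half_line"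
    by (rule borel_measurable_half_line) measurable
  \<comment> \<open>The point mass at 0 has transform 1, because
    \<open>0 powr \<alpha> = 0\<close>.\<close>
  then show ?case by (simp add: kendall_G_def integral_return)
next
  case (Suc n)
  with assms show ?case by (simp add: kendall_G_conv kendall_power_P_plus)
qed

text \<open>By \<open>cdf_plus_conv\<close>, F_(n+1) = G^n F + (F_n - G^n) G, so every convolution
  multiplies by G and adds one more F - G inside the bracket. Indexing by \<open>Suc n\<close>
  starts the induction at \<open>\<nu>\<close> and avoids truncated subtraction in the
  exponent.\<close>

lemma cdf_plus_kendall_power:
  assumes "\<alpha> > 0" "t > 0" "\<nu> \<in> P_plus"
  shows "cdf_plus (kendall_power \<alpha> \<nu> (Suc n)) t = kendall_G \<alpha> \<nu> t ^ n *
    (real (Suc n) * (cdf_plus \<nu> t - kendall_G \<alpha> \<nu> t) + kendall_G \<alpha> \<nu> t)"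
proof (induction n)
  case 0
  show ?case using kendall_power_1[OF assms(1,3)] by (simp del: kendall_power.simps)
next
  case (Suc n)
  have "cdf_plus (kendall_power \<alpha> \<nu> (Suc (Suc n))) t =
      kendall_G \<alpha> \<nu> t ^ Suc n * cdf_plus \<nu> t +
      (cdf_plus (kendall_power \<alpha> \<nu> (Suc n)) t - kendall_G \<alpha> \<nu> t ^ Suc n) * kendall_G \<alpha> \<nu> t"
    using cdf_plus_conv[OF assms(1,2) kendall_power_P_plus[OF assms(1,3), of "Suc n"] assms(3)]
      kendall_G_power[OF assms, of "Suc n"] by simp
  also have "\<dots> = kendall_G \<alpha> \<nu> t ^ Suc n *
      (real (Suc (Suc n)) * (cdf_plus \<nu> t - kendall_G \<alpha> \<nu> t) + kendall_G \<alpha> \<nu> t)"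
    unfolding Suc.IH by (simp add: algebra_simps)
  finally show ?case .
qed

text \<open>The infimum of the empty set is infinite, so a finite value is attained. This turns N(t)
  = n into finitely many inequalities for the walk.\<close>

lemma Inf_enat_image_eq_iff: "Inf (enat ` X) = enat n \<longleftrightarrow> n \<in> X \<and> (\<forall>k<n. k \<notin> X)"
proof
  assume eq: "Inf (enat ` X) = enat n"
  then have "X \<noteq> {}" by (auto simp: Inf_enat_def)
  then have "Inf (enat ` X) \<in> enat ` X" by (auto simp: Inf_enat_def intro: LeastI)
  moreover have "\<not> k < n" if "k \<in> X" for k
    using that eq Inf_lower[of "enat k" "enat ` X"] by auto
  ultimately show "n \<in> X \<and> (\<forall>k<n. k \<notin> X)" using eq by auto
next
  assume "n \<in> X \<and> (\<forall>k<n. k \<notin> X)"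
  then show "Inf (enat ` X) = enat n"
    by (intro antisym Inf_lower Inf_greatest) (auto simp: not_less[symmetric])
qed

section \<open>Laws of the random walk and its passage over a level\<close>

context kendall_random_walk
begin

text \<open>The event for \<open>S k\<close> lies in \<open>present M S k\<close>, so the joint
  probability is the integral over it of the conditional probability, which
  \<open>transition\<close> identifies with the kernel. A change of variables passes to the law of
  \<open>S k\<close>.\<close>

lemma measure_step:
  assumes "1 \<le> k" "A \<in> sets half_line" "B \<in> sets half_line" "\<alpha> > 0" "\<nu> \<in> P_plus"
  shows "measure M (S k -` B \<inter> S (Suc k) -` A \<inter> space M) =
    (\<integral>x. indicator B x * measure (kendall_conv \<alpha> (return half_line x) \<nu>) A \<partial>distr M half_line (S k))"
proof -
  let ?K = "\<lambda>x. measure (kendall_conv \<alpha> (return half_line x) \<nu>) A"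
  let ?C = "S k -` B \<inter> space M" and ?D = "S (Suc k) -` A \<inter> space M"
  note S [measurable] = random_variable[OF assms(1)]
  have K: "?K \<in> borel_measurable half_line"
    by (rule measurable_compose[OF measurable_kendall_conv_return[OF assms(4,5)]
          measurable_measure_prob_algebra[OF assms(2)]])
  have D: "?D \<in> sets M"
    using random_variable[of "Suc k"] assms by (auto intro: measurable_sets)
  have C: "?C \<in> sets M" "?C \<in> sets (present M S k)"
    using S assms by (auto intro: measurable_sets in_vimage_algebra simp: present_def)
  have sub: "subalgebra M (present M S k)"
    unfolding subalgebra_def present_def using measurable_sets[OF S]
    by (auto simp: sets_vimage_algebra2[OF measurable_space[OF S, THEN funcsetI]])
  interpret P: finite_measure_subalgebra M "present M S k"
    using sub by unfold_locales
  have "measure M (S k -` B \<inter> S (Suc k) -` A \<inter> space M) = (\<integral>\<omega>\<in>?C. indicator ?D \<omega> \<partial>M)"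
    using C D by (simp add: set_lebesgue_integral_def indicator_inter_arith[symmetric] Int_ac)
  also have "\<dots> = (\<integral>\<omega>\<in>?C. real_cond_exp M (present M S k) (indicator ?D) \<omega> \<partial>M)"
    using C D by (intro P.real_cond_exp_intA) (auto simp: emeasure_eq_measure)
  \<comment> \<open>For \<open>n = Suc k\<close> the kernel in \<open>transition\<close> involves
    the first convolution power, which is \<open>\<nu>\<close>.\<close>
  also have "\<dots> = (\<integral>\<omega>\<in>?C. ?K (S k \<omega>) \<partial>M)"
    using transition[of k "Suc k" A] assms C kendall_power_1[OF assms(4,5)]
      measurable_compose[OF S K]
    by (intro set_lebesgue_integral_cong_AE) auto
  also have "\<dots> = (\<integral>\<omega>. indicator B (S k \<omega>) * ?K (S k \<omega>) \<partial>M)"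
    unfolding set_lebesgue_integral_def
    by (intro Bochner_Integration.integral_cong) (auto simp: indicator_def)
  also have "\<dots> = (\<integral>x. indicator B x * ?K x \<partial>distr M half_line (S k))"
    by (intro integral_distr[symmetric] S borel_measurable_times borel_measurable_indicator assms(3) K)
  finally show ?thesis .
qed

text \<open>Taking \<open>B = {0..}\<close> in \<open>measure_step\<close> puts no condition on the
  current position, so the next law is the kernel averaged over the current one. This is exactly the
  recursion of \<open>kendall_power\<close>.\<close>

lemma distr_S:
  assumes "\<alpha> > 0" "\<nu> \<in> P_plus"
  shows "distr M half_line (S (Suc n)) = kendall_power \<alpha> \<nu> (Suc n)"
proof (induction n)
  case 0
  show ?case using initial kendall_power_1[OF assms] by (simp del: kendall_power.simps)
next
  case (Suc n)
  let ?\<mu> = "kendall_power \<alpha> \<nu> (Suc n)"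
  let ?K = "\<lambda>x. kendall_conv \<alpha> (return half_line x) \<nu>"
  have \<mu>: "?\<mu> \<in> P_plus" using assms by (rule kendall_power_P_plus)
  interpret \<mu>: prob_space ?\<mu> using \<mu> by (rule P_plus_prob_space)
  have "distr M half_line (S (Suc (Suc n))) = kendall_conv \<alpha> ?\<mu> \<nu>"
  proof (rule measure_eqI)
    show "sets (distr M half_line (S (Suc (Suc n)))) = sets (kendall_conv \<alpha> ?\<mu> \<nu>)"
      using P_plus_sets[OF kendall_conv_P_plus[OF assms(1) \<mu> assms(2)]] by simp
    fix A assume "A \<in> sets (distr M half_line (S (Suc (Suc n))))"
    then have A: "A \<in> sets half_line" by simp
    have m: "(\<lambda>x. measure (?K x) A) \<in> borel_measurable half_line"
      by (rule measurable_compose[OF measurable_kendall_conv_return[OF assms] measurable_measure_prob_algebra[OF A]])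
    have P: "prob_space (?K x)" if "0 \<le> x" for x
      using that assms by (intro P_plus_prob_space kendall_conv_P_plus return_P_plus)
    have sp: "space ?\<mu> = {0..}" using \<mu> by (rule P_plus_space)
    have "emeasure (distr M half_line (S (Suc (Suc n)))) A =
        ennreal (measure M (S (Suc n) -` {0..} \<inter> S (Suc (Suc n)) -` A \<inter> space M))"
      using random_variable[of "Suc (Suc n)"] random_variable[of "Suc n", THEN measurable_space] A
      by (simp add: emeasure_distr emeasure_eq_measure)
        (rule arg_cong[where f = prob], auto)
    also have "\<dots> = ennreal (\<integral>x. indicator {0..} x * measure (?K x) A \<partial>?\<mu>)"
      using measure_step[of "Suc n" A "{0..}"] A assms unfolding Suc.IH
      by (simp add: sets_half_line)
    also have "\<dots> = ennreal (\<integral>x. measure (?K x) A \<partial>?\<mu>)"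
      using sp by (intro arg_cong[where f = ennreal] Bochner_Integration.integral_cong) auto
    \<comment> \<open>Probabilities are bounded by 1, hence integrable; the nonnegative integral is
      the form in which a bind is evaluated on a set.\<close>
    also have "\<dots> = (\<integral>\<^sup>+x. ennreal (measure (?K x) A) \<partial>?\<mu>)"
    proof (intro nn_integral_eq_integral[symmetric] \<mu>.integrable_const_bound[of _ 1])
      show "AE x in ?\<mu>. norm (measure (?K x) A) \<le> 1"
        using P sp by (intro AE_I2) (auto simp: prob_space.prob_le_1)
      show "(\<lambda>x. measure (?K x) A) \<in> borel_measurable ?\<mu>"
        using m by (simp only: measurable_cong_sets[OF P_plus_sets[OF \<mu>] refl])
    qed simp
    also have "\<dots> = (\<integral>\<^sup>+x. emeasure (?K x) A \<partial>?\<mu>)"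
      using P sp by (intro nn_integral_cong)
        (auto simp: finite_measure.emeasure_eq_measure prob_space.finite_measure)
    also have "\<dots> = emeasure (?\<mu> \<bind> ?K) A"
      using \<mu> A measurable_kendall_conv_return[OF assms] unfolding P_plus_eq
      by (intro emeasure_bind_prob_algebra[symmetric])
    finally show "emeasure (distr M half_line (S (Suc (Suc n)))) A = emeasure (kendall_conv \<alpha> ?\<mu> \<nu>) A"
      unfolding kendall_conv_bind_return[OF assms(1) \<mu> assms(2)] .
  qed
  then show ?case by simp
qed

lemma prob_S_le:
  assumes "\<alpha> > 0" "\<nu> \<in> P_plus"
  shows "prob {\<omega> \<in> space M. S (Suc n) \<omega> \<le> t} = cdf_plus (kendall_power \<alpha> \<nu> (Suc n)) t"
proof -
  have "{\<omega> \<in> space M. S (Suc n) \<omega> \<le> t} = S (Suc n) -` {0..t} \<inter> space M"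
    using random_variable[of "Suc n", THEN measurable_space] by auto
  then show ?thesis
    using random_variable[of "Suc n"]
    by (simp add: distr_S[OF assms, symmetric] cdf_plus_def measure_distr sets_half_line
        del: kendall_power.simps)
qed

lemma sets_S_le: "{\<omega> \<in> space M. S (Suc n) \<omega> \<le> t} \<in> events"
proof -
  \<comment> \<open>Since \<open>{..t}\<close> is not a measurable set of \<open>half_line\<close>,
    the position is first regarded as a Borel function.\<close>
  have "S (Suc n) \<in> borel_measurable M"
    using measurable_compose[OF random_variable[of "Suc n"] borel_measurable_half_line[of "\<lambda>x. x"]]
    by simp
  then show ?thesis by measurable
qed

text \<open>The exceptional event is a step from beyond \<open>t\<close> into \<open>{0..t}\<close>.
  By \<open>measure_step\<close> its probability integrates the kernel mass of \<open>{0..t}\<close>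
  over starting points \<open>x > t\<close>, where that mass is 0.\<close>

lemma AE_S_le_mono:
  assumes "\<alpha> > 0" "\<nu> \<in> P_plus" "t > 0"
  shows "AE \<omega> in M. S (Suc (Suc n)) \<omega> \<le> t \<longrightarrow> S (Suc n) \<omega> \<le> t"
proof -
  let ?N = "S (Suc n) -` {t<..} \<inter> S (Suc (Suc n)) -` {0..t} \<inter> space M"
  have s: "{0..t} \<in> sets half_line" "{t<..} \<in> sets half_line"
    using assms by (auto simp: sets_half_line)
  have "prob ?N = (\<integral>x. indicator {t<..} x * measure (kendall_conv \<alpha> (return half_line x) \<nu>) {0..t}
      \<partial>distr M half_line (S (Suc n)))"
    using s assms by (intro measure_step) auto
  also have "\<dots> = (\<integral>x. 0 \<partial>distr M half_line (S (Suc n)))"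
    using assms kendall_conv_return_cdf_eq_0[of \<alpha> \<nu> t]
    by (intro Bochner_Integration.integral_cong) (auto simp: indicator_def)
  finally have "prob ?N = 0" by simp
  moreover have N: "?N = {\<omega> \<in> space M. \<not> (S (Suc (Suc n)) \<omega> \<le> t \<longrightarrow> S (Suc n) \<omega> \<le> t)}"
    using random_variable[of "Suc (Suc n)", THEN measurable_space] by auto
  moreover have "?N \<in> events"
  proof -
    have "?N = {\<omega> \<in> space M. S (Suc (Suc n)) \<omega> \<le> t} - {\<omega> \<in> space M. S (Suc n) \<omega> \<le> t}"
      unfolding N by auto
    then show ?thesis using sets_S_le by auto
  qed
  ultimately show ?thesis
    by (intro AE_I[of _ _ ?N]) (auto simp: emeasure_eq_measure)
qed

section \<open>Distribution of the renewal process\<close>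

lemma renewal_eq_iff: "renewal S t \<omega> = enat n \<longleftrightarrow> t < S (Suc n) \<omega> \<and> (\<forall>k<n. S (Suc k) \<omega> \<le> t)"
  by (auto simp: renewal_def Inf_enat_image_eq_iff not_less)

lemma prob_renewal_0:
  assumes "\<alpha> > 0" "\<nu> \<in> P_plus"
  shows "prob {\<omega> \<in> space M. renewal S t \<omega> = 0} = 1 - cdf_plus \<nu> t"
proof -
  have "{\<omega> \<in> space M. renewal S t \<omega> = 0} = space M - {\<omega> \<in> space M. S (Suc 0) \<omega> \<le> t}"
    by (auto simp: zero_enat_def renewal_eq_iff)
  then show ?thesis
    using prob_compl[OF sets_S_le] prob_S_le[OF assms, of 0] kendall_power_1[OF assms] by simp
qed

text \<open>Almost surely the events \<open>?L k\<close> decrease in \<open>k\<close>, so the bounds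
  on all earlier positions follow from the last one, and the probability is a difference for two
  nested events.\<close>

lemma prob_renewal_Suc:
  assumes "\<alpha> > 0" "\<nu> \<in> P_plus" "t > 0"
  shows "prob {\<omega> \<in> space M. renewal S t \<omega> = enat (Suc n)} =
    cdf_plus (kendall_power \<alpha> \<nu> (Suc n)) t - cdf_plus (kendall_power \<alpha> \<nu> (Suc (Suc n))) t"
proof -
  let ?L = "\<lambda>n. {\<omega> \<in> space M. S (Suc n) \<omega> \<le> t}"
  \<comment> \<open>Countably many null sets are discarded together, so that the implication can be
    iterated along a whole path.\<close>
  have "AE \<omega> in M. \<forall>n. S (Suc (Suc n)) \<omega> \<le> t \<longrightarrow> S (Suc n) \<omega> \<le> t"
    using AE_S_le_mono[OF assms] by (simp add: AE_all_countable)
  then have mono: "AE \<omega> in M. \<forall>k n. k \<le> n \<longrightarrow> S (Suc n) \<omega> \<le> t \<longrightarrow> S (Suc k) \<omega> \<le> t"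
  proof eventually_elim
    case (elim \<omega>)
    show ?case
    proof (intro allI impI)
      fix k n assume "k \<le> n" "S (Suc n) \<omega> \<le> t"
      then show "S (Suc k) \<omega> \<le> t"
        by (induction rule: inc_induct) (use elim in auto)
    qed
  qed
  \<comment> \<open>This exact description yields measurability; the simpler almost sure description
    yields the probability.\<close>
  have "{\<omega> \<in> space M. renewal S t \<omega> = enat (Suc n)} = (\<Inter>k\<in>{..n}. ?L k) - ?L (Suc n)"
    by (auto simp: renewal_eq_iff less_Suc_eq_le not_le)
  then have E: "{\<omega> \<in> space M. renewal S t \<omega> = enat (Suc n)} \<in> events"
    using sets_S_le by auto
  have "prob {\<omega> \<in> space M. renewal S t \<omega> = enat (Suc n)} = prob (?L n - ?L n \<inter> ?L (Suc n))"
    using E sets_S_le mono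
    by (intro finite_measure_eq_AE) (auto simp: renewal_eq_iff less_Suc_eq_le not_le elim!: eventually_mono)
  also have "\<dots> = prob (?L n) - prob (?L n \<inter> ?L (Suc n))"
    using sets_S_le by (intro finite_measure_Diff) auto
  \<comment> \<open>Up to a null set, \<open>?L (Suc n)\<close> is contained in
    \<open>?L n\<close>.\<close>
  also have "prob (?L n \<inter> ?L (Suc n)) = prob (?L (Suc n))"
    using sets_S_le AE_S_le_mono[OF assms, of n]
    by (intro finite_measure_eq_AE) (auto elim!: eventually_mono)
  finally show ?thesis
    using assms by (simp only: prob_S_le)
qed

end

theorem lemma4:
  fixes \<alpha> :: real and \<nu> :: "real measure"
  assumes "\<alpha> > 0" and "\<nu> \<in> P_plus"
  shows "(\<forall>n\<ge>1. \<forall>t>0.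
      cdf_plus (kendall_power \<alpha> \<nu> n) t =
        kendall_G \<alpha> \<nu> t ^ (n - 1) *
          (real n * (cdf_plus \<nu> t - kendall_G \<alpha> \<nu> t) + kendall_G \<alpha> \<nu> t) \<and>
      cdf_plus (kendall_power \<alpha> \<nu> n) t =
        kendall_G \<alpha> \<nu> t ^ (n - 1) *
          (real n * t powr (- \<alpha>) * kendall_H \<alpha> \<nu> t + kendall_G \<alpha> \<nu> t)) \<and>
    (\<forall>(M :: 'a measure) S. kendall_random_walk M \<alpha> \<nu> S \<longrightarrow> (\<forall>t>0.
      measure M {\<omega> \<in> space M. renewal S t \<omega> = 0} = 1 - cdf_plus \<nu> t \<and>
      (\<forall>n\<ge>1. measure M {\<omega> \<in> space M. renewal S t \<omega> = enat n} =
        kendall_G \<alpha> \<nu> t ^ (n - 1) *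
          (real n * (cdf_plus \<nu> t - kendall_G \<alpha> \<nu> t) * (1 - kendall_G \<alpha> \<nu> t)
            + kendall_G \<alpha> \<nu> t * (1 - cdf_plus \<nu> t)))))"
proof (intro conjI allI impI)
  fix n :: nat and t :: real assume n: "1 \<le> n" and t: "0 < t"
  then obtain m where m: "n = Suc m" by (cases n) auto
  show *: "cdf_plus (kendall_power \<alpha> \<nu> n) t = kendall_G \<alpha> \<nu> t ^ (n - 1) *
      (real n * (cdf_plus \<nu> t - kendall_G \<alpha> \<nu> t) + kendall_G \<alpha> \<nu> t)"
    using cdf_plus_kendall_power[OF assms(1) t assms(2), of m] by (simp add: m)
  have "cdf_plus \<nu> t - kendall_G \<alpha> \<nu> t = t powr (- \<alpha>) * kendall_H \<alpha> \<nu> t"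
    using cdf_plus_eq_G_plus_H[OF assms(1) t assms(2)] by simp
  with * show "cdf_plus (kendall_power \<alpha> \<nu> n) t = kendall_G \<alpha> \<nu> t ^ (n - 1) *
      (real n * t powr (- \<alpha>) * kendall_H \<alpha> \<nu> t + kendall_G \<alpha> \<nu> t)"
    by (simp add: mult.assoc)
next
  fix M :: "'a measure" and S and t :: real
  assume W: "kendall_random_walk M \<alpha> \<nu> S" and t: "0 < t"
  interpret kendall_random_walk M \<alpha> \<nu> S by (rule W)
  show "prob {\<omega> \<in> space M. renewal S t \<omega> = 0} = 1 - cdf_plus \<nu> t"
    using assms by (rule prob_renewal_0)
  fix n :: nat assume "1 \<le> n"
  then obtain m where m: "n = Suc m" by (cases n) auto
  show "prob {\<omega> \<in> space M. renewal S t \<omega> = enat n} = kendall_G \<alpha> \<nu> t ^ (n - 1) *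
      (real n * (cdf_plus \<nu> t - kendall_G \<alpha> \<nu> t) * (1 - kendall_G \<alpha> \<nu> t)
        + kendall_G \<alpha> \<nu> t * (1 - cdf_plus \<nu> t))"
    \<comment> \<open>With D = F - G, taking G^(n-1) out of F_n - F_(n+1) leaves n D + G - G ((n+1)
      D + G), which is n D (1 - G) + G (1 - F) because F = D + G.\<close>
    unfolding m prob_renewal_Suc[OF assms t] cdf_plus_kendall_power[OF assms(1) t assms(2)]
    by (simp add: algebra_simps)
qed

end
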